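(* Let $G$ be a finite abelian group. Then $\mathcal{GP}(G)$ is planar if and only if one of the following holds: (1) $G$ is an elementary abelian $2$-group; (2) $G$ is an elementary abelian $3$-group; (3) $G$ is an elementary abelian $5$-group; (4) $G\cong \mathbb{Z}_4$; (5) $G\cong \mathbb{Z}_6$.
   Context: For a group $G$, the generalized power graph $\mathcal{GP}(G)$ is the simple undirected graph whose vertices are the non-identity elements of $G$, two distinct vertices $a,b$ being adjacent if and only if $\langle a\rangle\cap\langle b\rangle\neq 1$. $\mathbb{Z}_m$ denotes the cyclic group of order $m$. The trivial group counts as an elementary abelian $p$-group (of rank $0$), and the graph with no vertices counts as planar. *)

theory Defs
  imports "HOL-Analysis.Analysis" "HOL-Algebra.Algebra"
begin

text \<open>A simple undirected graph is a pair of its vertex set and its edge set, the edges being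
  two-element sets of vertices.\<close>

type_synonym 'a sgraph = "'a set \<times> 'a set set"

text \<open>The map \<open>p\<close> places the vertices in the plane and \<open>\<gamma> e\<close> is a Jordan arc joining the
  two end vertices of the edge \<open>e\<close>. An arc meets no vertices other than its ends, and two distinct
  arcs meet only in common end vertices. The plane is the type \<^typ>\<open>complex\<close>, as in the library's
  Jordan curve theorem.\<close>

definition plane_drawing ::
    "'a sgraph \<Rightarrow> ('a \<Rightarrow> complex) \<Rightarrow> ('a set \<Rightarrow> real \<Rightarrow> complex) \<Rightarrow> bool" where
  "plane_drawing \<Gamma> p \<gamma> \<longleftrightarrow>
     inj_on p (fst \<Gamma>) \<and>
     (\<forall>e \<in> snd \<Gamma>. arc (\<gamma> e) \<and> {pathstart (\<gamma> e), pathfinish (\<gamma> e)} = p ` e) \<and>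
     (\<forall>e \<in> snd \<Gamma>. \<forall>v \<in> fst \<Gamma>. p v \<in> path_image (\<gamma> e) \<longrightarrow> v \<in> e) \<and>
     (\<forall>e \<in> snd \<Gamma>. \<forall>f \<in> snd \<Gamma>. e \<noteq> f \<longrightarrow>
        path_image (\<gamma> e) \<inter> path_image (\<gamma> f) \<subseteq> p ` (e \<inter> f))"

definition planar :: "'a sgraph \<Rightarrow> bool" where
  "planar \<Gamma> \<longleftrightarrow> (\<exists>p \<gamma>. plane_drawing \<Gamma> p \<gamma>)"

definition generalized_power_graph :: "('a, 'b) monoid_scheme \<Rightarrow> 'a sgraph" where
  "generalized_power_graph G =
     (carrier G - {\<one>\<^bsub>G\<^esub>},
      {{a, b} | a b. a \<in> carrier G - {\<one>\<^bsub>G\<^esub>} \<and> b \<in> carrier G - {\<one>\<^bsub>G\<^esub>} \<and> a \<noteq> b \<and>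
                     generate G {a} \<inter> generate G {b} \<noteq> {\<one>\<^bsub>G\<^esub>}})"

text \<open>The trivial group qualifies for every prime \<open>p\<close>.\<close>

definition elementary_abelian_group :: "nat \<Rightarrow> ('a, 'b) monoid_scheme \<Rightarrow> bool" where
  "elementary_abelian_group p G \<longleftrightarrow>
     Factorial_Ring.prime p \<and> comm_group G \<and> (\<forall>x \<in> carrier G - {\<one>\<^bsub>G\<^esub>}. group.ord G x = p)"

end

theory Submission
  imports Defs
begin

text \<open>All elements of the group having a fixed \<open>z \<noteq> 1\<close> as a power are pairwise adjacent, so planarity
  allows at most four of them. Five such elements are easily found in a cyclic group of order at least
  \<open>7\<close>, and in a group strictly larger than a cyclic subgroup of order \<open>4\<close> or \<open>6\<close> with the same exponent;
  since coprime orders multiply, only the listed groups remain. Conversely, their graphs are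
  disjoint unions of copies of subgraphs of \<open>K\<^sub>5\<close> minus two adjacent edges, which have straight-line
  drawings.

  That \<open>K\<^sub>5\<close> has no drawing by Jordan arcs comes from the theta-curve theorem: among four internally
  disjoint arcs with the same ends, given by one edge and the three paths of length two, the edge and
  one of the paths form a closed curve separating the other two paths, although their middle
  vertices are joined by an edge that avoids this curve.\<close>

subsection \<open>Jordan arcs with common ends\<close>

definition two_arcs :: "complex \<Rightarrow> complex \<Rightarrow> (real \<Rightarrow> complex) \<Rightarrow> (real \<Rightarrow> complex) \<Rightarrow> bool" where
  "two_arcs a b c d \<longleftrightarrow>
     arc c \<and> pathstart c = a \<and> pathfinish c = b \<and>
     arc d \<and> pathstart d = a \<and> pathfinish d = b \<and>
     path_image c \<inter> path_image d = {a, b}"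

abbreviation encl :: "(real \<Rightarrow> complex) \<Rightarrow> (real \<Rightarrow> complex) \<Rightarrow> complex set" where
  "encl c d \<equiv> inside (path_image c \<union> path_image d)"

lemma encl_commute: "encl c d = encl d c"
  by (simp add: Un_commute)

lemma two_arcs_commute: "two_arcs a b c d \<Longrightarrow> two_arcs a b d c"
  by (auto simp: two_arcs_def)

lemma two_arcs_ends_neq: "two_arcs a b c d \<Longrightarrow> a \<noteq> b"
  by (auto simp: two_arcs_def dest: arc_distinct_ends)

lemma two_arcs_interior:
  assumes "two_arcs a b c d" "x \<in> path_image c - {a, b}"
  shows "x \<notin> path_image d"
proof
  assume "x \<in> path_image d"
  moreover have "path_image c \<inter> path_image d = {a, b}"
    using assms(1) by (simp add: two_arcs_def)
  ultimately show False
    using assms(2) by blast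
qed

lemma encl_not_on:
  assumes "x \<in> encl c d"
  shows "x \<notin> path_image c" "x \<notin> path_image d"
  using assms inside_no_overlap[of "path_image c \<union> path_image d"] by blast+

lemma two_arcs_Jordan:
  assumes "two_arcs a b c d"
  shows "connected (encl c d)" "encl c d \<noteq> {}"
    "frontier (encl c d) = path_image c \<union> path_image d"
proof -
  have sp: "simple_path (c +++ reversepath d)"
    using assms by (intro simple_path_join_loop) (auto simp: two_arcs_def arc_reversepath)
  have loop: "pathfinish (c +++ reversepath d) = pathstart (c +++ reversepath d)"
    using assms by (auto simp: two_arcs_def)
  have im: "path_image (c +++ reversepath d) = path_image c \<union> path_image d"
    using assms by (subst path_image_join) (auto simp: two_arcs_def)
  show "connected (encl c d)" "encl c d \<noteq> {}"
    "frontier (encl c d) = path_image c \<union> path_image d"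
    using Jordan_inside_outside[OF sp loop] unfolding im by auto
qed

lemma inside_connected_subset:
  assumes "connected T" "T \<inter> S = {}" "x \<in> T" "y \<in> T" "x \<in> inside S"
  shows "y \<in> inside S"
proof -
  have "connected_component (- S) x y"
    using assms by (intro connected_componentI[of T]) auto
  then show ?thesis
    using assms(5) inside_same_component by blast
qed

text \<open>Without its ends the arc is connected and avoids the closed curve, so it lies on one
  side of it as a whole.\<close>

lemma arc_inside_encl:
  assumes c: "two_arcs a b c1 c" "two_arcs a b c2 c"
    and x: "x \<in> path_image c - {a, b}" and y: "y \<in> path_image c" "y \<in> encl c1 c2"
  shows "x \<in> encl c1 c2"
proof (rule inside_connected_subset[of "path_image c - {a, b}" _ y])
  show "connected (path_image c - {a, b})"
    using connected_simple_path_endless[of c] c(1) by (auto simp: two_arcs_def arc_imp_simple_path)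
  have "{a, b} \<subseteq> path_image c1"
    using c by (auto simp: two_arcs_def)
  then show "y \<in> path_image c - {a, b}"
    using y inside_no_overlap[of "path_image c1 \<union> path_image c2"] by blast
  show "(path_image c - {a, b}) \<inter> (path_image c1 \<union> path_image c2) = {}"
    using c[THEN two_arcs_commute, THEN two_arcs_interior] by blast
qed (rule x y)+

lemma split_encl:
  assumes "two_arcs a b c1 c2" "two_arcs a b c1 c" "two_arcs a b c2 c"
    and x: "x \<in> path_image c" "x \<in> encl c1 c2"
  shows "encl c1 c2 = encl c1 c \<union> encl c2 c \<union> (path_image c - {a, b})"
proof (rule split_inside_simple_closed_curve[of c1 a b c2 c])
  assume "encl c1 c \<union> encl c2 c \<union> (path_image c - {a, b}) = encl c1 c2"
  then show ?thesis
    by (rule sym)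
qed (use assms two_arcs_ends_neq[OF assms(1)] in \<open>auto simp: two_arcs_def arc_imp_simple_path\<close>)

text \<open>If the two insides shared a point, each would be a connected set avoiding the boundary
  of the other, hence contained in the other. Equal insides have equal frontiers, but
  \<open>x3\<close> lies on only one of these.\<close>

lemma encl_disjoint:
  assumes c: "two_arcs a b c1 c2" "two_arcs a b c1 c3" "two_arcs a b c2 c3"
    and out: "path_image c3 \<inter> encl c1 c2 = {}" "path_image c2 \<inter> encl c1 c3 = {}"
    and x3: "x3 \<in> path_image c3 - {a, b}"
  shows "encl c1 c2 \<inter> encl c1 c3 = {}"
proof (rule ccontr)
  assume "encl c1 c2 \<inter> encl c1 c3 \<noteq> {}"
  then obtain z where z: "z \<in> encl c1 c2" "z \<in> encl c1 c3"
    by auto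
  have "encl c d \<subseteq> encl c e"
    if "two_arcs a b c d" "path_image e \<inter> encl c d = {}" "z \<in> encl c d" "z \<in> encl c e" for c d e
  proof
    fix y assume "y \<in> encl c d"
    moreover have "encl c d \<inter> (path_image c \<union> path_image e) = {}"
      using that(2) inside_no_overlap[of "path_image c \<union> path_image d"] by blast
    ultimately show "y \<in> encl c e"
      using inside_connected_subset[OF two_arcs_Jordan(1)[OF that(1)] _ that(3)] that(4) by simp
  qed
  from this[OF c(1) out(1) z] this[OF c(2) out(2) z(2,1)]
  have "encl c1 c2 = encl c1 c3"
    by (rule antisym)
  then have "frontier (encl c1 c2) = frontier (encl c1 c3)"
    by (rule arg_cong)
  then have "path_image c1 \<union> path_image c2 = path_image c1 \<union> path_image c3"
    unfolding two_arcs_Jordan(3)[OF c(1)] two_arcs_Jordan(3)[OF c(2)] .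
  moreover have "x3 \<notin> path_image c1" "x3 \<notin> path_image c2"
    by (rule two_arcs_interior[OF c(2)[THEN two_arcs_commute] x3]
        two_arcs_interior[OF c(3)[THEN two_arcs_commute] x3])+
  ultimately show False
    using x3 by blast
qed

text \<open>If each arc ran outside the closed curve formed by the two others, then by Janiszewski's
  theorem a point enclosed by \<open>c1\<close> and \<open>c3\<close> would be joined to infinity off \<open>c1 \<union> c2 \<union> c3\<close>: it is
  enclosed neither by \<open>c1 \<union> c2\<close> nor by \<open>c2 \<union> c3\<close>, and these two curves meet in the arc \<open>c2\<close>.\<close>

lemma middle_arc:
  assumes c: "two_arcs a b c1 c2" "two_arcs a b c1 c3" "two_arcs a b c2 c3"
    and x: "x1 \<in> path_image c1 - {a, b}" "x2 \<in> path_image c2 - {a, b}"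
      "x3 \<in> path_image c3 - {a, b}"
  shows "x1 \<in> encl c2 c3 \<or> x2 \<in> encl c1 c3 \<or> x3 \<in> encl c1 c2"
proof (rule ccontr)
  assume "\<not> ?thesis"
  then have out: "path_image c1 \<inter> encl c2 c3 = {}" "path_image c2 \<inter> encl c1 c3 = {}"
      "path_image c3 \<inter> encl c1 c2 = {}"
    using arc_inside_encl[OF c(1,2)[THEN two_arcs_commute] x(1)]
      arc_inside_encl[OF c(1) c(3)[THEN two_arcs_commute] x(2)] arc_inside_encl[OF c(2,3) x(3)]
    by auto
  let ?S = "path_image c1 \<union> path_image c2" and ?T = "path_image c2 \<union> path_image c3"
  obtain y where y: "y \<in> encl c1 c3"
    using two_arcs_Jordan(2)[OF c(2)] by auto
  have d: "encl c1 c3 \<inter> encl c1 c2 = {}" "encl c3 c1 \<inter> encl c3 c2 = {}"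
    using encl_disjoint[OF c(2,1) two_arcs_commute[OF c(3)] out(2,3) x(2)]
      encl_disjoint[OF two_arcs_commute[OF c(2)] two_arcs_commute[OF c(3)] c(1) _ _ x(2)] out
    by (auto simp: encl_commute[of c3])
  have y_off: "y \<notin> path_image c1" "y \<notin> path_image c2" "y \<notin> path_image c3"
    using y out inside_no_overlap[of "path_image c1 \<union> path_image c3"] by blast+
  have comp: "compact ?S" "compact ?T" "compact (?S \<union> ?T)"
    using c by (auto simp: two_arcs_def compact_arc_image intro!: compact_Un)
  have "y \<in> outside ?S" "y \<in> outside ?T"
    using d y y_off by (auto simp: outside_inside encl_commute)
  \<comment> \<open>The point \<open>z\<close> stands for infinity: it lies outside all three closed
    curves.\<close>
  moreover obtain z where z: "z \<in> outside (?S \<union> ?T)"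
    using unbounded_outside[OF compact_imp_bounded[OF comp(3)]] by (metis bounded_empty ex_in_conv)
  then have "z \<in> outside ?S" "z \<in> outside ?T"
    using outside_mono[of ?S "?S \<union> ?T"] outside_mono[of ?T "?S \<union> ?T"] by auto
  moreover have "connected (outside ?S)" "connected (outside ?T)"
    using comp by (auto intro!: connected_outside compact_imp_bounded)
  moreover have "outside ?S \<subseteq> - ?S" "outside ?T \<subseteq> - ?T"
    using outside_no_overlap[of ?S] outside_no_overlap[of ?T] by blast+
  ultimately have "connected_component (- ?S) y z" "connected_component (- ?T) y z"
    by (metis connected_componentI)+
  moreover have "?S \<inter> ?T = path_image c2"
    using c by (auto simp: two_arcs_def)
  then have "connected (?S \<inter> ?T)"
    using c by (auto simp: two_arcs_def connected_arc_image)
  ultimately have "connected_component (- (?S \<union> ?T)) y z"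
    using Janiszewski[OF comp(1) compact_imp_closed[OF comp(2)]] by blast
  then have "connected_component (- (path_image c1 \<union> path_image c3)) y z"
    by (rule connected_component_of_subset) auto
  then have "z \<in> encl c1 c3"
    using y inside_same_component by blast
  moreover have "z \<in> outside (path_image c1 \<union> path_image c3)"
    using z outside_mono[of "path_image c1 \<union> path_image c3" "?S \<union> ?T"] by auto
  ultimately show False
    using inside_Int_outside by blast
qed

text \<open>If \<open>ci\<close> ran inside \<open>c0 \<union> cj\<close>, so would
  \<open>ck\<close> by \<open>same\<close>. Then \<open>xk\<close> would lie between
  \<open>ci\<close> and \<open>cj\<close>, and \<open>xi\<close> between \<open>cj\<close> and
  \<open>ck\<close>; but \<open>ck\<close> splits \<open>encl ci cj\<close>, so \<open>xi\<close>
  would be enclosed by a curve on which it lies.\<close>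

lemma four_arcs_not_enclosed:
  assumes c: "two_arcs a b c0 ci" "two_arcs a b c0 cj" "two_arcs a b c0 ck"
      "two_arcs a b ci cj" "two_arcs a b ci ck" "two_arcs a b cj ck"
    and x: "xi \<in> path_image ci - {a, b}" "xj \<in> path_image cj - {a, b}"
      "xk \<in> path_image ck - {a, b}"
    and same: "xj \<in> encl c0 ci \<longleftrightarrow> xk \<in> encl c0 ci" "xi \<in> encl c0 cj \<longleftrightarrow> xk \<in> encl c0 cj"
      "xi \<in> encl c0 ck \<longleftrightarrow> xj \<in> encl c0 ck"
  shows "xi \<notin> encl c0 cj"
proof
  assume i: "xi \<in> encl c0 cj"
  then have k: "xk \<in> encl c0 cj"
    using same by simp
  have xc: "xi \<in> path_image ci" "xj \<in> path_image cj" "xk \<in> path_image ck"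
    using x by blast+
  then have off: "xj \<notin> encl c0 cj" "xi \<notin> encl ci cj"
    by (meson encl_not_on)+
  have off': "xk \<notin> path_image ci" "xi \<notin> path_image ck"
    using two_arcs_interior[OF c(5) x(1)] two_arcs_interior[OF c(5)[THEN two_arcs_commute] x(3)]
    by blast+
  have split_i: "encl c0 cj = encl c0 ci \<union> encl cj ci \<union> (path_image ci - {a, b})"
    by (rule split_encl[OF c(2,1) c(4)[THEN two_arcs_commute] xc(1) i])
  have split_k: "encl c0 cj = encl c0 ck \<union> encl cj ck \<union> (path_image ck - {a, b})"
    by (rule split_encl[OF c(2,3,6) xc(3) k])
  \<comment> \<open>By \<open>same\<close> this concerns \<open>xj\<close>, which lies on
    \<open>cj\<close> and hence not in the larger region \<open>encl c0 cj\<close>.\<close>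
  have "xk \<notin> encl c0 ci"
    using split_i off(1) same(1) by blast
  then have "xk \<in> encl ci cj"
    using split_i k off'(1) unfolding encl_commute[of ci] by blast
  then have "encl ci cj = encl ci ck \<union> encl cj ck \<union> (path_image ck - {a, b})"
    by (rule split_encl[OF c(4,5,6) xc(3)])
  moreover have "xi \<notin> encl c0 ck"
    using split_k off(1) same(3) by blast
  then have "xi \<in> encl cj ck"
    using split_k i off'(2) by blast
  ultimately show False
    using off(2) by blast
qed

text \<open>Informally: in the cyclic order of the four arcs, the one opposite to \<open>c0\<close> together with \<open>c0\<close>
  separates the other two.\<close>

lemma four_arcs_separate:
  assumes c: "two_arcs a b c0 c1" "two_arcs a b c0 c2" "two_arcs a b c0 c3"
      "two_arcs a b c1 c2" "two_arcs a b c1 c3" "two_arcs a b c2 c3"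
    and x: "x0 \<in> path_image c0 - {a, b}" "x1 \<in> path_image c1 - {a, b}"
      "x2 \<in> path_image c2 - {a, b}" "x3 \<in> path_image c3 - {a, b}"
    and same: "x2 \<in> encl c0 c1 \<longleftrightarrow> x3 \<in> encl c0 c1" "x1 \<in> encl c0 c2 \<longleftrightarrow> x3 \<in> encl c0 c2"
      "x1 \<in> encl c0 c3 \<longleftrightarrow> x2 \<in> encl c0 c3"
  shows False
proof -
  have n: "x1 \<notin> encl c0 c2" "x2 \<notin> encl c0 c1" "x1 \<notin> encl c0 c3"
    by (rule four_arcs_not_enclosed[OF c x(2-4) same]
        four_arcs_not_enclosed[OF c(2,1,3) c(4)[THEN two_arcs_commute] c(6,5) x(3,2,4)
          same(2,1) same(3)[symmetric]]
        four_arcs_not_enclosed[OF c(1,3,2,5,4) c(6)[THEN two_arcs_commute] x(2,4,3)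
          same(1)[symmetric] same(3,2)])+
  have n': "x3 \<notin> encl c0 c1" "x3 \<notin> encl c0 c2" "x2 \<notin> encl c0 c3"
    using same n by blast+
  \<comment> \<open>Among \<open>c0\<close>, \<open>ci\<close>, \<open>cj\<close> only
    \<open>c0\<close> can be the middle arc, so it splits \<open>encl ci cj\<close> into two
    regions, neither of which contains \<open>xk\<close>.\<close>
  have outside: "xk \<notin> encl ci cj"
    if "two_arcs a b c0 ci" "two_arcs a b c0 cj" "two_arcs a b ci cj" "two_arcs a b c0 ck"
      and xs: "xi \<in> path_image ci - {a, b}" "xj \<in> path_image cj - {a, b}" "xk \<in> path_image ck - {a, b}"
      and "xi \<notin> encl c0 cj" "xj \<notin> encl c0 ci" "xk \<notin> encl c0 ci" "xk \<notin> encl c0 cj"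
    for ci cj ck xi xj xk
  proof -
    have "x0 \<in> encl ci cj"
      using middle_arc[OF that(1-3) x(1) xs(1,2)] that(8,9) by blast
    then have "encl ci cj = encl ci c0 \<union> encl cj c0 \<union> (path_image c0 - {a, b})"
      using x(1) by (intro split_encl[OF that(3) that(1,2)[THEN two_arcs_commute]]) blast
    moreover have "xk \<notin> path_image c0"
      by (rule two_arcs_interior[OF that(4)[THEN two_arcs_commute] xs(3)])
    ultimately show ?thesis
      using that(10,11) unfolding encl_commute[of _ c0] by blast
  qed
  have "x3 \<notin> encl c1 c2" "x2 \<notin> encl c1 c3" "x1 \<notin> encl c2 c3"
    by (rule outside[OF c(1,2,4,3) x(2,3,4) n(1,2) n'(1,2)]
        outside[OF c(1,3,5,2) x(2,4,3) n(3) n'(1) n(2) n'(3)]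
        outside[OF c(2,3,6,1) x(3,4,2) n'(3,2) n(1,3)])+
  then show False
    using middle_arc[OF c(4-6) x(2-4)] by blast
qed

section \<open>The complete graph on five vertices\<close>

text \<open>Edges are unordered, so a drawing leaves the direction of an arc open; reversing it
  where necessary lets arcs be joined to paths.\<close>

lemma plane_drawing_oriented_arc:
  assumes "plane_drawing \<Gamma> p \<gamma>" "{u, v} \<in> snd \<Gamma>"
  obtains g where "arc g" "pathstart g = p u" "pathfinish g = p v" "path_image g = path_image (\<gamma> {u, v})"
proof -
  have "arc (\<gamma> {u, v})" "{pathstart (\<gamma> {u, v}), pathfinish (\<gamma> {u, v})} = {p u, p v}"
    using assms by (auto simp: plane_drawing_def)
  then consider "pathstart (\<gamma> {u, v}) = p u" "pathfinish (\<gamma> {u, v}) = p v"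
    | "pathstart (\<gamma> {u, v}) = p v" "pathfinish (\<gamma> {u, v}) = p u"
    by (auto simp: doubleton_eq_iff)
  then show thesis
    using that[of "\<gamma> {u, v}"] that[of "reversepath (\<gamma> {u, v})"] \<open>arc (\<gamma> {u, v})\<close>
    by cases (auto simp: arc_reversepath)
qed

text \<open>Two vertices \<open>u\<close>, \<open>v\<close> of a \<open>K\<^sub>5\<close> are joined by four arcs: the edge \<open>uv\<close> and the paths
  through each of the other vertices. An edge between two of the latter avoids the closed curve
  formed by the other two arcs.\<close>

theorem planar_no_K5:
  assumes "planar \<Gamma>" "W \<subseteq> fst \<Gamma>" "card W = 5"
    and complete: "\<And>u v. u \<in> W \<Longrightarrow> v \<in> W \<Longrightarrow> u \<noteq> v \<Longrightarrow> {u, v} \<in> snd \<Gamma>"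
  shows False
proof -
  obtain p \<gamma> where D: "plane_drawing \<Gamma> p \<gamma>"
    using assms by (auto simp: planar_def)
  obtain u v w1 w2 w3 where W: "W = {u, v, w1, w2, w3}" and dist: "distinct [u, v, w1, w2, w3]"
  proof -
    obtain xs where xs: "set xs = W" "distinct xs"
      using finite_distinct_list[of W] assms(3) card.infinite by fastforce
    then have "length xs = 5"
      using distinct_card assms(3) by metis
    then obtain u v w1 w2 w3 where "xs = [u, v, w1, w2, w3]"
      by (auto simp: numeral_eq_Suc length_Suc_conv)
    then show thesis
      using xs that[of u v w1 w2 w3] by auto
  qed
  have uv: "u \<in> W" "v \<in> W" "u \<noteq> v"
    and ws: "w1 \<in> W" "w1 \<noteq> u" "w1 \<noteq> v" "w2 \<in> W" "w2 \<noteq> u" "w2 \<noteq> v" "w3 \<in> W" "w3 \<noteq> u" "w3 \<noteq> v"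
    and w_neq: "w1 \<noteq> w2" "w1 \<noteq> w3" "w2 \<noteq> w3"
    using W dist by auto
  have inj: "inj_on p W"
    using D assms(2) unfolding plane_drawing_def by (meson inj_on_subset)
  define E where "E y z = path_image (\<gamma> {y, z})" for y z
  have E_sym: "E y z = E z y" for y z
    by (simp add: E_def insert_commute)
  have "\<exists>h. arc h \<and> pathstart h = p y \<and> pathfinish h = p z \<and> path_image h = E y z"
    if "y \<in> W" "z \<in> W" "y \<noteq> z" for y z
    using plane_drawing_oriented_arc[OF D complete[OF that]] unfolding E_def by metis
  then obtain g where g: "\<And>y z. y \<in> W \<Longrightarrow> z \<in> W \<Longrightarrow> y \<noteq> z \<Longrightarrow> arc (g y z) \<and> pathstart (g y z) = p y \<and>
      pathfinish (g y z) = p z \<and> path_image (g y z) = E y z"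
    by metis
  have ends: "p y \<in> E y z" "p z \<in> E y z" if "y \<in> W" "z \<in> W" "y \<noteq> z" for y z
    using g[OF that] by (metis pathstart_in_path_image pathfinish_in_path_image)+
  have meet: "E y z \<inter> E y' z' \<subseteq> p ` ({y, z} \<inter> {y', z'})"
    if "y \<in> W" "z \<in> W" "y \<noteq> z" "y' \<in> W" "z' \<in> W" "y' \<noteq> z'" "{y, z} \<noteq> {y', z'}" for y z y' z'
    using D complete[OF that(1-3)] complete[OF that(4-6)] that(7)
    unfolding plane_drawing_def E_def by simp
  have meet1: "E y z \<inter> E y z' = {p y}"
    if "y \<in> W" "z \<in> W" "y \<noteq> z" "z' \<in> W" "y \<noteq> z'" "z \<noteq> z'" for y z z'
  proof
    have "{y, z} \<inter> {y, z'} = {y}" and neq: "{y, z} \<noteq> {y, z'}"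
      using that by auto
    then show "E y z \<inter> E y z' \<subseteq> {p y}"
      using meet[OF that(1-3,1,4,5) neq] by (simp only: image_insert image_empty)
    show "{p y} \<subseteq> E y z \<inter> E y z'"
      using ends(1)[OF that(1-3)] ends(1)[OF that(1,4,5)] by simp
  qed
  have meet0: "E y z \<inter> E y' z' = {}"
    if "y \<in> W" "z \<in> W" "y \<noteq> z" "y' \<in> W" "z' \<in> W" "y' \<noteq> z'" "y \<noteq> y'" "y \<noteq> z'" "z \<noteq> y'" "z \<noteq> z'"
    for y z y' z'
  proof -
    have "{y, z} \<inter> {y', z'} = {}" "{y, z} \<noteq> {y', z'}"
      using that by auto
    then show ?thesis
      using meet[OF that(1-6)] by simp
  qed
  define via where "via w = g u w +++ g w v" for w
  have via_im: "path_image (via w) = E u w \<union> E w v" if w: "w \<in> W" "w \<noteq> u" "w \<noteq> v" for w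
    unfolding via_def using g[OF uv(1) w(1) w(2)[symmetric]] g[OF w(1) uv(2) w(3)]
    by (subst path_image_join) simp_all
  have via: "arc (via w) \<and> pathstart (via w) = p u \<and> pathfinish (via w) = p v"
    if w: "w \<in> W" "w \<noteq> u" "w \<noteq> v" for w
  proof -
    have "E u w \<inter> E w v = {p w}"
      using meet1[of w u v] w uv by (simp add: E_sym[of u w])
    then show ?thesis
      unfolding via_def using g[OF uv(1) w(1) w(2)[symmetric]] g[OF w(1) uv(2) w(3)]
      by (simp add: arc_join)
  qed
  have two_via: "two_arcs (p u) (p v) (via w) (via w')"
    if w: "w \<in> W" "w \<noteq> u" "w \<noteq> v" "w' \<in> W" "w' \<noteq> u" "w' \<noteq> v" "w \<noteq> w'" for w w'
  proof -
    have "E u w \<inter> E u w' = {p u}" "E w v \<inter> E w' v = {p v}" "E u w \<inter> E w' v = {}"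
        "E w v \<inter> E u w' = {}"
      using meet1[of u w w'] meet1[of v w w'] meet0[of u w w' v] meet0[of w v u w'] w uv
      by (simp_all add: E_sym[of _ v])
    then have "path_image (via w) \<inter> path_image (via w') = {p u, p v}"
      unfolding via_im[OF w(1-3)] via_im[OF w(4-6)] Int_Un_distrib Int_Un_distrib2 by auto
    then show ?thesis
      using via[OF w(1-3)] via[OF w(4-6)] by (simp add: two_arcs_def)
  qed
  have two_direct: "two_arcs (p u) (p v) (g u v) (via w)" if w: "w \<in> W" "w \<noteq> u" "w \<noteq> v" for w
  proof -
    have "E u v \<inter> E u w = {p u}" "E u v \<inter> E w v = {p v}"
      using meet1[of u v w] meet1[of v u w] w uv by (simp_all add: E_sym[of _ v])
    then have "E u v \<inter> path_image (via w) = {p u, p v}"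
      unfolding via_im[OF w] Int_Un_distrib by auto
    then show ?thesis
      using via[OF w] g[OF uv] by (simp add: two_arcs_def)
  qed
  have mid: "p w \<in> path_image (via w) - {p u, p v}" if w: "w \<in> W" "w \<noteq> u" "w \<noteq> v" for w
    using inj_on_eq_iff[OF inj w(1) uv(1)] inj_on_eq_iff[OF inj w(1) uv(2)] via_im[OF w]
      ends(2)[OF uv(1) w(1)] w by simp
  have same: "p w \<in> encl (g u v) (via z) \<longleftrightarrow> p w' \<in> encl (g u v) (via z)"
    if w: "w \<in> W" "w \<noteq> u" "w \<noteq> v" and w': "w' \<in> W" "w' \<noteq> u" "w' \<noteq> v"
      and z: "z \<in> W" "z \<noteq> u" "z \<noteq> v" and neq: "w \<noteq> w'" "w \<noteq> z" "w' \<noteq> z" for w w' z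
  proof -
    have "E w w' \<inter> E u v = {}" "E w w' \<inter> E u z = {}" "E w w' \<inter> E z v = {}"
      using w w' z neq uv by (intro meet0; simp)+
    then have "E w w' \<inter> (path_image (g u v) \<union> path_image (via z)) = {}"
      using g[OF uv] by (simp add: via_im[OF z] Int_Un_distrib)
    moreover have "connected (E w w')"
      using g[OF w(1) w'(1) neq(1)] connected_arc_image by metis
    ultimately show ?thesis
      using inside_connected_subset ends[OF w(1) w'(1) neq(1)] by metis
  qed
  \<comment> \<open>The edge \<open>uv\<close> carries no middle vertex, so an arbitrary inner point
    takes that role.\<close>
  obtain x0 where x0: "x0 \<in> path_image (g u v) - {p u, p v}"
    using nonempty_simple_path_endless[of "g u v"] g[OF uv] arc_imp_simple_path by fastforce
  show False
  proof (rule four_arcs_separate)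
    show "x0 \<in> path_image (g u v) - {p u, p v}"
      by (rule x0)
    show "p w1 \<in> path_image (via w1) - {p u, p v}" "p w2 \<in> path_image (via w2) - {p u, p v}"
      "p w3 \<in> path_image (via w3) - {p u, p v}"
      by (intro mid ws)+
  qed (intro two_direct two_via same ws w_neq w_neq[symmetric])+
qed

subsection \<open>Straight-line drawings\<close>

text \<open>The relation \<open>A\<close> orients the edges; its diagonal pairs \<open>(v, v)\<close> make \<open>cross\<close> also say that no
  edge passes through a further vertex.\<close>

lemma straight_line_planar:
  fixes p :: "'a \<Rightarrow> complex"
  assumes inj: "inj_on p (fst \<Gamma>)"
    and A: "A \<subseteq> fst \<Gamma> \<times> fst \<Gamma>" "\<And>v. v \<in> fst \<Gamma> \<Longrightarrow> (v, v) \<in> A"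
    and edge: "\<And>e. e \<in> snd \<Gamma> \<Longrightarrow> \<exists>a b. (a, b) \<in> A \<and> e = {a, b} \<and> a \<noteq> b"
    and cross: "\<And>a b c d. (a, b) \<in> A \<Longrightarrow> (c, d) \<in> A \<Longrightarrow> {a, b} \<noteq> {c, d} \<Longrightarrow>
      closed_segment (p a) (p b) \<inter> closed_segment (p c) (p d) \<subseteq> p ` ({a, b} \<inter> {c, d})"
  shows "planar \<Gamma>"
proof -
  obtain l r where lr: "(l e, r e) \<in> A" "e = {l e, r e}" "l e \<noteq> r e" if "e \<in> snd \<Gamma>" for e
    using edge by metis
  define \<gamma> where "\<gamma> e = linepath (p (l e)) (p (r e))" for e
  have im: "path_image (\<gamma> e) = closed_segment (p (l e)) (p (r e))" for e
    by (simp add: \<gamma>_def)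
  have "arc (\<gamma> e)" "{pathstart (\<gamma> e), pathfinish (\<gamma> e)} = p ` e" if e: "e \<in> snd \<Gamma>" for e
  proof -
    have "p (l e) \<noteq> p (r e)"
      using inj lr(1,3)[OF e] A(1) by (auto dest: inj_onD)
    then show "arc (\<gamma> e)"
      by (simp add: \<gamma>_def)
    show "{pathstart (\<gamma> e), pathfinish (\<gamma> e)} = p ` e"
      using arg_cong[OF lr(2)[OF e], of "image p"] by (simp add: \<gamma>_def)
  qed
  moreover have "v \<in> e" if e: "e \<in> snd \<Gamma>" and v: "v \<in> fst \<Gamma>" "p v \<in> path_image (\<gamma> e)" for e v
  proof (rule ccontr)
    assume "v \<notin> e"
    moreover from this have "{v, v} \<noteq> {l e, r e}"
      using lr(2)[OF e] by blast
    ultimately show False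
      using cross[OF A(2)[OF v(1)] lr(1)[OF e]] v(2) lr(2)[OF e] by (auto simp: im)
  qed
  moreover have "path_image (\<gamma> e) \<inter> path_image (\<gamma> f) \<subseteq> p ` (e \<inter> f)"
    if "e \<in> snd \<Gamma>" "f \<in> snd \<Gamma>" "e \<noteq> f" for e f
    using cross[OF lr(1)[OF that(1)] lr(1)[OF that(2)]] lr(2)[OF that(1)] lr(2)[OF that(2)] that(3)
    unfolding im by metis
  ultimately have "plane_drawing \<Gamma> p \<gamma>"
    unfolding plane_drawing_def using inj by blast
  then show ?thesis
    by (auto simp: planar_def)
qed

text \<open>Five points drawing \<open>K\<^sub>5\<close> minus the edges \<open>24\<close> and \<open>34\<close>: point \<open>3\<close> lies inside the triangle
  \<open>012\<close>, and point \<open>4\<close> on the other side of its edge \<open>01\<close>. The pairs \<open>(r, r)\<close> in \<open>cells\<close> stand for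
  the vertices, as degenerate segments.\<close>

definition abscissa :: "nat \<Rightarrow> real" where "abscissa r = [0, 0, 3, 1, -1] ! r"
definition ordinate :: "nat \<Rightarrow> real" where "ordinate r = [0, 4, 2, 2, 2] ! r"

definition cells :: "(nat \<times> nat) set" where
  "cells = {(0,0), (1,1), (2,2), (3,3), (4,4), (0,1), (0,2), (0,3), (0,4), (1,2), (1,3), (1,4), (2,3)}"

text \<open>For each pair of cells both coordinate equations become linear in \<open>u\<close> and
  \<open>v\<close> with numeral coefficients, so a finite case check by arithmetic suffices.\<close>

lemma cells_meet:
  assumes "(r, s) \<in> cells" "(r', s') \<in> cells" "(r, s) \<noteq> (r', s')"
    and "0 \<le> u" "u \<le> 1" "0 \<le> v" "v \<le> 1"
    and "(1 - u) * abscissa r + u * abscissa s = (1 - v) * abscissa r' + v * abscissa s'"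
    and "(1 - u) * ordinate r + u * ordinate s = (1 - v) * ordinate r' + v * ordinate s'"
  shows "\<exists>t \<in> {r, s} \<inter> {r', s'}. (1 - u) * abscissa r + u * abscissa s = abscissa t \<and>
    (1 - u) * ordinate r + u * ordinate s = ordinate t"
  using assms unfolding cells_def
  by (elim insertE emptyE) (simp_all add: abscissa_def ordinate_def)

text \<open>Each copy of the five-point drawing stays in a horizontal strip of height 4, so copies
  shifted up by different multiples of 5 are disjoint.\<close>

lemma ordinate_bounds:
  assumes "(r, s) \<in> cells" "0 \<le> u" "u \<le> 1"
  shows "0 \<le> (1 - u) * ordinate r + u * ordinate s" "(1 - u) * ordinate r + u * ordinate s \<le> 4"
  using assms unfolding cells_def
  by (elim insertE emptyE; simp add: ordinate_def; linarith?)+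

text \<open>The map \<open>q\<close> numbers the copies and \<open>r\<close> names the point within
  a copy; a copy is drawn \<open>5 * q a\<close> above the base position.\<close>

lemma planar_disjoint_union_K5_minus_two_edges:
  fixes q r :: "'a \<Rightarrow> nat"
  assumes edge: "\<And>e. e \<in> snd \<Gamma> \<Longrightarrow> \<exists>a b. a \<in> fst \<Gamma> \<and> b \<in> fst \<Gamma> \<and> e = {a, b} \<and> a \<noteq> b \<and>
      q a = q b \<and> (r a, r b) \<in> cells"
    and r: "\<And>a. a \<in> fst \<Gamma> \<Longrightarrow> r a < 5"
    and qr: "\<And>a b. a \<in> fst \<Gamma> \<Longrightarrow> b \<in> fst \<Gamma> \<Longrightarrow> q a = q b \<Longrightarrow> r a = r b \<Longrightarrow> a = b"
  shows "planar \<Gamma>"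
proof -
  define p where "p a = Complex (abscissa (r a)) (ordinate (r a) + 5 * q a)" for a
  define A where "A = {(a, b). a \<in> fst \<Gamma> \<and> b \<in> fst \<Gamma> \<and> q a = q b \<and> (r a, r b) \<in> cells}"
  have rr: "(r a, r a) \<in> cells" if "a \<in> fst \<Gamma>" for a
  proof -
    have "r a \<in> {0, 1, 2, 3, 4}"
      using r[OF that] by auto
    then show ?thesis
      by (auto simp: cells_def)
  qed
  have seg: "\<exists>u. 0 \<le> u \<and> u \<le> 1 \<and> Re z = (1 - u) * abscissa (r a) + u * abscissa (r b) \<and>
      Im z = (1 - u) * ordinate (r a) + u * ordinate (r b) + 5 * q a"
    if ab: "(a, b) \<in> A" and z: "z \<in> closed_segment (p a) (p b)" for a b z
  proof -
    obtain u where u: "0 \<le> u" "u \<le> 1" and z_eq: "z = (1 - u) *\<^sub>R p a + u *\<^sub>R p b"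
      using z by (auto simp: closed_segment_def)
    then show ?thesis
      using ab u by (intro exI[of _ u]) (simp add: z_eq A_def p_def algebra_simps)
  qed
  have cross: "closed_segment (p a) (p b) \<inter> closed_segment (p c) (p d) \<subseteq> p ` ({a, b} \<inter> {c, d})"
    if ab: "(a, b) \<in> A" and cd: "(c, d) \<in> A" and neq: "{a, b} \<noteq> {c, d}" for a b c d
  proof
    fix z assume z: "z \<in> closed_segment (p a) (p b) \<inter> closed_segment (p c) (p d)"
    obtain u where u: "0 \<le> u" "u \<le> 1" "Re z = (1 - u) * abscissa (r a) + u * abscissa (r b)"
        "Im z = (1 - u) * ordinate (r a) + u * ordinate (r b) + 5 * q a"
      using seg[OF ab] z by blast
    obtain v where v: "0 \<le> v" "v \<le> 1" "Re z = (1 - v) * abscissa (r c) + v * abscissa (r d)"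
        "Im z = (1 - v) * ordinate (r c) + v * ordinate (r d) + 5 * q c"
      using seg[OF cd] z by blast
    have cells: "(r a, r b) \<in> cells" "(r c, r d) \<in> cells"
      and V: "a \<in> fst \<Gamma>" "b \<in> fst \<Gamma>" "c \<in> fst \<Gamma>" "d \<in> fst \<Gamma>"
      and q': "q b = q a" "q d = q c"
      using ab cd by (auto simp: A_def)
    \<comment> \<open>A common point lies in both strips, so the shifts differ by at most 4; being
      multiples of 5, they agree.\<close>
    have "real (5 * q a) \<le> real (5 * q c + 4)" "real (5 * q c) \<le> real (5 * q a + 4)"
      using ordinate_bounds[OF cells(1) u(1,2)] ordinate_bounds[OF cells(2) v(1,2)] u(4) v(4)
      unfolding of_nat_add of_nat_numeral by linarith+
    then have q: "q a = q c"
      unfolding of_nat_le_iff by linarith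
    have "(r a, r b) \<noteq> (r c, r d)"
      using qr[OF V(1,3)] qr[OF V(2,4)] q q' neq by auto
    \<comment> \<open>The segments share a label \<open>t\<close>; within one copy,
      \<open>qr\<close> turns it into a shared vertex.\<close>
    then obtain t where t: "t \<in> {r a, r b} \<inter> {r c, r d}" "Re z = abscissa t" "Im z = ordinate t + 5 * q a"
      using cells_meet[OF cells _ u(1,2) v(1,2)] u v q by auto
    have "t \<in> r ` {a, b}" "t \<in> r ` {c, d}"
      using t(1) by simp_all
    then obtain w w' where w: "w \<in> {a, b}" "t = r w" and w': "w' \<in> {c, d}" "t = r w'"
      by (elim imageE)
    have "w = w'"
      using qr[of w w'] w w' V q q' by auto
    moreover have "z = p w"
      using t(2,3) w q' by (auto simp: p_def complex_eq_iff)
    ultimately show "z \<in> p ` ({a, b} \<inter> {c, d})"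
      using w w' by blast
  qed
  show ?thesis
  proof (rule straight_line_planar[of p _ A])
    show "inj_on p (fst \<Gamma>)"
    proof (rule inj_onI)
      fix a b assume ab: "a \<in> fst \<Gamma>" "b \<in> fst \<Gamma>" "p a = p b"
      then have "(a, a) \<in> A" "(b, b) \<in> A"
        using rr by (auto simp: A_def)
      then show "a = b"
        using cross[of a a b b] ab(3) by auto
    qed
    show "A \<subseteq> fst \<Gamma> \<times> fst \<Gamma>"
      by (auto simp: A_def)
    show "(v, v) \<in> A" if "v \<in> fst \<Gamma>" for v
      using that rr by (auto simp: A_def)
    show "\<exists>a b. (a, b) \<in> A \<and> e = {a, b} \<and> a \<noteq> b" if "e \<in> snd \<Gamma>" for e
      using edge[OF that] by (auto simp: A_def)
  qed (rule cross)
qed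

text \<open>The labels 0 to 3 are pairwise joined in \<open>cells\<close>, so a class of at most
  four vertices, numbered arbitrarily, can be drawn whatever its edges are.\<close>

lemma planar_small_classes:
  fixes q :: "'a \<Rightarrow> 'c"
  assumes fin: "finite (fst \<Gamma>)"
    and edge: "\<And>e. e \<in> snd \<Gamma> \<Longrightarrow> \<exists>a b. a \<in> fst \<Gamma> \<and> b \<in> fst \<Gamma> \<and> e = {a, b} \<and> a \<noteq> b \<and> q a = q b"
    and small: "\<And>a. a \<in> fst \<Gamma> \<Longrightarrow> card {b \<in> fst \<Gamma>. q b = q a} \<le> 4"
  shows "planar \<Gamma>"
proof -
  obtain f :: "'c \<Rightarrow> nat" where f: "inj_on f (q ` fst \<Gamma>)"
    using finite_imp_inj_to_nat_seg[OF finite_imageI[OF fin]] by metis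
  have "\<exists>h. bij_betw h {b \<in> fst \<Gamma>. q b = k} {0..<card {b \<in> fst \<Gamma>. q b = k}}" for k
    using fin by (intro ex_bij_betw_finite_nat) simp
  then obtain h where h: "bij_betw (h k) {b \<in> fst \<Gamma>. q b = k} {0..<card {b \<in> fst \<Gamma>. q b = k}}" for k
    by metis
  define r where "r a = h (q a) a" for a
  have r4: "r a < 4" if "a \<in> fst \<Gamma>" for a
    using bij_betw_apply[OF h[of "q a"], of a] small[OF that] that by (simp add: r_def)
  have inj: "a = b" if "a \<in> fst \<Gamma>" "b \<in> fst \<Gamma>" "q a = q b" "r a = r b" for a b
    using bij_betw_imp_inj_on[OF h[of "q a"]] that unfolding r_def by (auto dest: inj_onD)
  have cells: "(i, j) \<in> cells" if "i < j" "j < 4" for i j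
  proof -
    have "j \<in> {0, 1, 2, 3}" "i \<in> {0, 1, 2, 3}"
      using that by auto
    then show ?thesis
      using that by (auto simp: cells_def)
  qed
  show ?thesis
  proof (rule planar_disjoint_union_K5_minus_two_edges[of _ "\<lambda>a. f (q a)" r])
    fix e assume "e \<in> snd \<Gamma>"
    then obtain a b where ab: "a \<in> fst \<Gamma>" "b \<in> fst \<Gamma>" "e = {a, b}" "a \<noteq> b" "q a = q b"
      using edge by blast
    then have "r a \<noteq> r b"
      using inj by blast
    then consider "r a < r b" | "r b < r a"
      by linarith
    then show "\<exists>a b. a \<in> fst \<Gamma> \<and> b \<in> fst \<Gamma> \<and> e = {a, b} \<and> a \<noteq> b \<and> f (q a) = f (q b) \<and> (r a, r b) \<in> cells"
    proof cases
      case 1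
      then show ?thesis
        using ab cells[OF 1 r4[OF ab(2)]] by (intro exI[of _ a] exI[of _ b]) simp
    next
      case 2
      then show ?thesis
        using ab cells[OF 2 r4[OF ab(1)]]
        by (intro exI[of _ b] exI[of _ a]) (simp add: insert_commute)
    qed
  next
    show "r a < 5" if "a \<in> fst \<Gamma>" for a
      using r4[OF that] by simp
    show "a = b" if "a \<in> fst \<Gamma>" "b \<in> fst \<Gamma>" "f (q a) = f (q b)" "r a = r b" for a b
      using inj[OF that(1,2) _ that(4)] inj_onD[OF f that(3)] that by blast
  qed
qed

subsection \<open>Cliques in generalized power graphs\<close>

lemma (in group) planar_no_clique:
  assumes planar: "planar (generalized_power_graph G)"
    and z: "z \<noteq> \<one>"
    and xs: "distinct xs" "length xs = 5" "set xs \<subseteq> carrier G"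
    and root: "\<And>x. x \<in> set xs \<Longrightarrow> \<exists>k::nat. x [^] k = z"
  shows False
proof (rule planar_no_K5[OF planar])
  have nontrivial: "x \<noteq> \<one>" if "x \<in> set xs" for x
    using root[OF that] z by auto
  then show "set xs \<subseteq> fst (generalized_power_graph G)"
    using xs(3) by (auto simp: generalized_power_graph_def)
  show "card (set xs) = 5"
    using distinct_card[OF xs(1)] xs(2) by simp
  have "z \<in> generate G {x}" if x: "x \<in> set xs" for x
  proof -
    obtain k :: nat where "x [^] k = z"
      using root[OF x] by blast
    then have "z = x [^] int k"
      by (simp add: int_pow_int)
    then show ?thesis
      using generate_pow[of x] xs(3) x by blast
  qed
  moreover fix x y assume xy: "x \<in> set xs" "y \<in> set xs" "x \<noteq> y"
  ultimately have "generate G {x} \<inter> generate G {y} \<noteq> {\<one>}"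
    using z by blast
  moreover have "x \<in> carrier G - {\<one>}" "y \<in> carrier G - {\<one>}"
    using xy nontrivial xs(3) by auto
  ultimately show "{x, y} \<in> snd (generalized_power_graph G)"
    unfolding generalized_power_graph_def snd_conv using xy(3) by blast
qed

lemma (in group) pow_mod_ord:
  assumes "x \<in> carrier G"
  shows "x [^] (n mod ord x) = x [^] (n::nat)"
proof -
  have "x [^] n = x [^] (ord x * (n div ord x)) \<otimes> x [^] (n mod ord x)"
    using assms by (simp add: nat_pow_mult)
  also have "x [^] (ord x * (n div ord x)) = \<one>"
    using assms by (simp add: pow_eq_id)
  finally show ?thesis
    using assms by simp
qed

text \<open>The clique consists of the elements \<open>a\<^sup>i\<close> for \<open>i\<close> in \<open>is\<close> and \<open>a\<^sup>j b\<close> for \<open>j\<close> in \<open>js\<close>, all of which have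
  a power equal to \<open>a\<^sup>e\<close>.\<close>

lemma (in comm_group) planar_no_coset_clique:
  assumes planar: "planar (generalized_power_graph G)"
    and a: "a \<in> carrier G" and b: "b \<in> carrier G" "js = [] \<or> b \<notin> range (\<lambda>k::nat. a [^] k)"
    and lists: "distinct is" "distinct js" "length is + length js = 5"
      "\<forall>i \<in> set is \<union> set js. i < ord a"
    and e: "0 < e" "e < ord a"
    and pow_is: "\<forall>i \<in> set is. \<exists>k::nat. i * k mod ord a = e"
    and pow_js: "\<forall>j \<in> set js. \<exists>k::nat. j * k mod ord a = e \<and> b [^] k = \<one>"
  shows False
proof -
  have inj: "i = j" if "a [^] i = a [^] j" "i < ord a" "j < ord a" for i j :: nat
    using inj_onD[OF ord_inj[OF a] that(1)] that(2,3) by auto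
  have not_pow: "a [^] i \<otimes> b \<noteq> a [^] j" if "js \<noteq> []" for i j :: nat
  proof
    assume eq: "a [^] i \<otimes> b = a [^] j"
    \<comment> \<open>The natural number \<open>ord a * i - i\<close> is an exponent for the inverse
      of \<open>a [^] i\<close>; the inequality keeps the subtraction exact.\<close>
    have "i \<le> ord a * i"
      using e by simp
    then have "a [^] (ord a * i - i) \<otimes> a [^] i = \<one>"
      using a by (simp add: nat_pow_mult pow_eq_id)
    then have "b = a [^] (ord a * i - i) \<otimes> (a [^] i \<otimes> b)"
      using a b by (simp add: m_assoc[symmetric])
    then have "b = a [^] (ord a * i - i + j)"
      using a by (simp add: eq nat_pow_mult)
    then show False
      using b(2) that by blast
  qed
  let ?xs = "map (\<lambda>i. a [^] i) is @ map (\<lambda>j. a [^] j \<otimes> b) js"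
  show False
  proof (rule planar_no_clique[OF planar, of "a [^] e" ?xs])
    show "a [^] e \<noteq> \<one>"
      using e a by (auto simp: pow_eq_id dest: dvd_imp_le)
    have "inj_on (\<lambda>i. a [^] i) (set is)"
      using lists(4) inj by (auto intro!: inj_onI)
    moreover have "inj_on (\<lambda>j. a [^] j \<otimes> b) (set js)"
    proof (rule inj_onI)
      fix i j assume "i \<in> set js" "j \<in> set js" "a [^] i \<otimes> b = a [^] j \<otimes> b"
      then show "i = j"
        using lists(4) inj[of i j] a b by simp
    qed
    moreover have "a [^] i \<noteq> a [^] j \<otimes> b" if "j \<in> set js" for i j :: nat
      using not_pow[of j i] that by force
    ultimately show "distinct ?xs"
      using lists(1,2) by (auto simp: distinct_map)
    show "length ?xs = 5"
      using lists(3) by simp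
    show "set ?xs \<subseteq> carrier G"
      using a b by auto
    have step: "(a [^] i) [^] k = a [^] e" if "i * k mod ord a = e" for i k :: nat
      using pow_mod_ord[OF a, of "i * k"] that a by (simp add: nat_pow_pow)
    fix x assume "x \<in> set ?xs"
    then consider i where "i \<in> set is" "x = a [^] i" | j where "j \<in> set js" "x = a [^] j \<otimes> b"
      by auto
    then show "\<exists>k::nat. x [^] k = a [^] e"
    proof cases
      case 1
      then show ?thesis
        using pow_is step by blast
    next
      case 2
      then obtain k :: nat where k: "j * k mod ord a = e" "b [^] k = \<one>"
        using pow_js by blast
      then have "x [^] k = a [^] e"
        using 2 a b step[OF k(1)] by (simp add: nat_pow_distrib)
      then show ?thesis ..
    qed
  qed
qed

text \<open>From order 7 on, five powers of \<open>x\<close> have a common nontrivial power: for odd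
  order five generators will do, and for even order \<open>2 * m\<close> the odd powers share the
  involution \<open>x [^] m\<close>.\<close>

lemma (in comm_group) planar_ord_le_6:
  assumes planar: "planar (generalized_power_graph G)" and fin: "finite (carrier G)"
    and x: "x \<in> carrier G"
  shows "ord x \<le> 6"
proof (rule ccontr)
  assume "\<not> ?thesis"
  then have n: "7 \<le> ord x"
    by simp
  \<comment> \<open>With \<open>b\<close> trivial and \<open>js\<close> empty, all five elements are
    powers of \<open>x\<close>.\<close>
  note clique = planar_no_coset_clique[OF planar x one_closed disjI1[OF refl] _ distinct.simps(1)[THEN iffD2, OF TrueI]]
  show False
  proof (cases "odd (ord x)")
    case True
    then obtain m where m: "ord x = 2 * m + 1"
      by (rule oddE)
    with n have "3 \<le> m"
      by simp
    then obtain l where l: "m = l + 3"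
      by (metis add.commute le_Suc_ex)
    \<comment> \<open>Modulo \<open>2 * m + 1\<close>, the exponents \<open>m + 1\<close>,
      \<open>2 * m - 1\<close> and \<open>2 * m\<close> are 1/2, -2 and -1, with inverses 2,
      \<open>m\<close> and -1. The bound \<open>3 \<le> m\<close> makes \<open>m + 1\<close> and
      \<open>2 * m - 1\<close> distinct.\<close>
    have mod: "(m + 1) * 2 mod ord x = 1" "(2 * m - 1) * m mod ord x = 1" "2 * m * (2 * m) mod ord x = 1"
    proof -
      have *: "(ord x * q + 1) mod ord x = 1" for q
        unfolding mod_mult_self4 using n by simp
      have "(m + 1) * 2 = ord x * 1 + 1" "(2 * m - 1) * m = ord x * (m - 1) + 1"
          "2 * m * (2 * m) = ord x * (2 * m - 1) + 1"
        by (simp_all add: m l algebra_simps)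
      then show "(m + 1) * 2 mod ord x = 1" "(2 * m - 1) * m mod ord x = 1"
          "2 * m * (2 * m) mod ord x = 1"
        using * by metis+
    qed
    show False
    proof (rule clique[of "[1, 2, m + 1, 2 * m - 1, 2 * m]" 1])
      show "\<forall>i \<in> set [1, 2, m + 1, 2 * m - 1, 2 * m]. \<exists>k. i * k mod ord x = 1"
      proof -
        have "1 * 1 mod ord x = 1"
          using n by simp
        moreover have "2 * (m + 1) mod ord x = 1"
          using mod(1) by (simp add: mult.commute)
        ultimately show ?thesis
          using mod by (metis empty_iff empty_set set_ConsD)
      qed
    qed (use n m l in auto)
  next
    case False
    then obtain m where m: "ord x = 2 * m"
      by (auto elim: evenE)
    have mod: "i * m mod ord x = m" if "odd i" for i
    proof -
      obtain q where "i = 2 * q + 1"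
        using \<open>odd i\<close> by (rule oddE)
      then have "i * m = m + ord x * q"
        by (simp add: m algebra_simps)
      then show ?thesis
        using n by (simp add: m)
    qed
    consider "m = 4" | "5 \<le> m"
      using n m by linarith
    then show False
    proof cases
      \<comment> \<open>Only four odd exponents lie below 8, so the involution itself, with exponent
        4, is the fifth vertex.\<close>
      case 1
      then have "\<forall>i \<in> set [1, 3, 4, 5, 7]. \<exists>k. i * k mod ord x = m"
        using m by (auto intro: exI[of _ 1] exI[of _ 4])
      then show False
        using 1 m by (intro clique[of "[1, 3, 4, 5, 7]" m]) auto
    next
      case 2
      then have "\<forall>i \<in> set [1, 3, 5, 7, 9]. \<exists>k. i * k mod ord x = m"
        using mod[of 1] mod[of 3] mod[of 5] mod[of 7] mod[of 9] by auto
      then show False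
        using 2 m by (intro clique[of "[1, 3, 5, 7, 9]" m]) auto
    qed
  qed
qed

text \<open>Raising \<open>x \<otimes> y\<close> to the power \<open>?N * ord y\<close> gives the
  identity and removes \<open>y\<close>, so \<open>ord x\<close> divides \<open>?N * ord y\<close>,
  hence \<open>?N\<close> by coprimality; symmetrically for \<open>ord y\<close>.\<close>

lemma (in comm_group) ord_mult_dvd_ord_mult:
  assumes x: "x \<in> carrier G" and y: "y \<in> carrier G" and coprime: "coprime (ord x) (ord y)"
  shows "ord x * ord y dvd ord (x \<otimes> y)"
proof -
  let ?N = "ord (x \<otimes> y)"
  have pow: "x [^] (?N * k) \<otimes> y [^] (?N * k) = \<one>" for k :: nat
  proof -
    have "(x \<otimes> y) [^] (?N * k) = \<one>"
      using x y by (simp add: pow_eq_id)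
    then show ?thesis
      using x y by (simp add: nat_pow_distrib)
  qed
  have "y [^] (?N * ord y) = \<one>" "x [^] (?N * ord x) = \<one>"
    using x y by (simp_all add: pow_eq_id)
  then have "x [^] (?N * ord y) = \<one>" "y [^] (?N * ord x) = \<one>"
    using pow[of "ord y"] pow[of "ord x"] x y by simp_all
  then have "ord x dvd ?N * ord y" "ord y dvd ?N * ord x"
    using x y by (simp_all add: pow_eq_id)
  then have "ord x dvd ?N" "ord y dvd ?N"
    using coprime by (simp_all add: coprime_dvd_mult_left_iff coprime_commute)
  then show ?thesis
    using coprime by (simp add: divides_mult)
qed

section \<open>Recognizing the cyclic groups of orders 4 and 6\<close>

text \<open>The isomorphism is built in the opposite direction, sending a residue \<open>i\<close>
  to \<open>a [^] i\<close>, and then inverted.\<close>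

lemma (in group) cyclic_imp_iso_integer_mod_group:
  assumes fin: "finite (carrier G)" and a: "a \<in> carrier G"
    and gen: "\<And>y. y \<in> carrier G \<Longrightarrow> y \<in> range (\<lambda>k::nat. a [^] k)"
  shows "G \<cong> integer_mod_group (ord a)"
proof -
  let ?Z = "integer_mod_group (ord a)" and ?h = "\<lambda>i::int. a [^] i"
  have pos: "ord a > 0"
    using ord_ge_1[OF fin a] by simp
  then have carrier: "carrier ?Z = {0..<int (ord a)}"
    by (simp add: carrier_integer_mod_group)
  have mod: "a [^] (i mod int (ord a)) = a [^] i" for i :: int
  proof -
    have "a [^] (i div int (ord a) * int (ord a)) = \<one>"
      using a by (simp add: int_pow_eq_id)
    then show ?thesis
      using int_pow_mult[OF a, of "i div int (ord a) * int (ord a)" "i mod int (ord a)"] a by simp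
  qed
  have "?h \<in> hom ?Z G"
    using a by (auto intro!: homI simp: mod int_pow_mult)
  moreover have "bij_betw ?h (carrier ?Z) (carrier G)"
  proof (rule bij_betw_imageI)
    have pow_nat: "a [^] nat i = a [^] i" if "i \<in> carrier ?Z" for i
      using that int_pow_int[of G a "nat i"] by (simp add: carrier)
    show "inj_on ?h (carrier ?Z)"
    proof (rule inj_onI)
      fix i j assume ij: "i \<in> carrier ?Z" "j \<in> carrier ?Z" "a [^] i = a [^] j"
      have "nat i = nat j"
      proof (rule inj_onD[OF ord_inj[OF a]])
        show "a [^] nat i = a [^] nat j"
          using ij(3) by (simp only: pow_nat[OF ij(1)] pow_nat[OF ij(2)])
        show "nat i \<in> {0..ord a - 1}" "nat j \<in> {0..ord a - 1}"
          using ij(1,2) by (auto simp: carrier)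
      qed
      then show "i = j"
        using ij(1,2) by (simp add: carrier eq_nat_nat_iff)
    qed
    show "?h ` carrier ?Z = carrier G"
    proof
      show "?h ` carrier ?Z \<subseteq> carrier G"
        using a by auto
      show "carrier G \<subseteq> ?h ` carrier ?Z"
      proof
        fix y assume "y \<in> carrier G"
        then obtain k :: nat where "y = a [^] k"
          using gen by blast
        then have "y = a [^] (int k mod int (ord a))"
          by (simp add: mod int_pow_int)
        then show "y \<in> ?h ` carrier ?Z"
          using pos by (simp add: carrier)
      qed
    qed
  qed
  ultimately have "?Z \<cong> G"
    by (auto simp: is_iso_def iso_def)
  then show ?thesis
    using group.iso_sym[OF group_integer_mod_group] by blast
qed

text \<open>An element \<open>b\<close> of square 1 that is not a power of \<open>a\<close> would
  give the clique a, a^2, a^3, ab, a^3 b of roots of a^2. A general \<open>y\<close> is reduced to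
  this case on division by a power of \<open>a\<close> with the same square.\<close>

lemma (in comm_group) planar_ord_4_iso:
  assumes planar: "planar (generalized_power_graph G)" and fin: "finite (carrier G)"
    and a: "a \<in> carrier G" "ord a = 4" and pow4: "\<And>y. y \<in> carrier G \<Longrightarrow> y [^] (4::nat) = \<one>"
  shows "G \<cong> integer_mod_group 4"
proof -
  let ?H = "range (\<lambda>k::nat. a [^] k)"
  have square: "b \<in> ?H" if b: "b \<in> carrier G" "b [^] (2::nat) = \<one>" for b
  proof (rule ccontr)
    assume H: "b \<notin> ?H"
    have "\<forall>j \<in> set [1, 3]. \<exists>k::nat. j * k mod ord a = 2 \<and> b [^] k = \<one>"
      using a(2) b(2) by (auto intro: exI[of _ 2])
    moreover have "\<forall>i \<in> set [1, 2, 3]. \<exists>k::nat. i * k mod ord a = 2"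
      using a(2) by (auto intro: exI[of _ 1] exI[of _ 2])
    ultimately show False
      using planar_no_coset_clique[OF planar a(1) b(1), of "[1, 3]" "[1, 2, 3]" 2] a(2) H by auto
  qed
  have "y \<in> ?H" if y: "y \<in> carrier G" for y
  proof -
    have "(y [^] (2::nat)) [^] (2::nat) = \<one>"
      using pow4[OF y] y by (simp add: nat_pow_pow)
    then obtain k :: nat where k: "y [^] (2::nat) = a [^] k"
      using square[of "y [^] (2::nat)"] y by auto
    then have "a [^] (k * 2) = \<one>"
      using pow4[OF y] y a by (metis nat_pow_pow numeral_Bit0 mult_2 one_add_one mult.commute)
    then have "4 dvd k * 2"
      using a by (simp add: pow_eq_id)
    then obtain l where l: "k = 2 * l"
      by (auto elim!: dvdE)
    \<comment> \<open>As \<open>a\<close> has order 4, \<open>a [^] (3 * l)\<close> is the inverse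
      of \<open>a [^] l\<close>, whose square is that of \<open>y\<close>.\<close>
    have "(a [^] (3 * l) \<otimes> y) [^] (2::nat) = a [^] (3 * l * 2) \<otimes> a [^] (2 * l)"
      using a y k l by (simp add: nat_pow_distrib nat_pow_pow)
    then have "(a [^] (3 * l) \<otimes> y) [^] (2::nat) = \<one>"
      using a by (simp add: nat_pow_mult pow_eq_id)
    then obtain m :: nat where m: "a [^] (3 * l) \<otimes> y = a [^] m"
      using square[of "a [^] (3 * l) \<otimes> y"] a y by auto
    have "y = a [^] l \<otimes> (a [^] (3 * l) \<otimes> y)"
      using a y by (simp add: m_assoc[symmetric] nat_pow_mult pow_eq_id)
    then show ?thesis
      using a by (simp add: m nat_pow_mult)
  qed
  then show ?thesis
    using cyclic_imp_iso_integer_mod_group[OF fin a(1)] a(2) by simp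
qed

text \<open>Elements of order dividing 2 or 3 are powers of \<open>a\<close>, since otherwise there
  are five roots of a^2 or of a^3, respectively; a general \<open>y\<close> is a product of such
  elements.\<close>

lemma (in comm_group) planar_ord_6_iso:
  assumes planar: "planar (generalized_power_graph G)" and fin: "finite (carrier G)"
    and a: "a \<in> carrier G" "ord a = 6" and pow6: "\<And>y. y \<in> carrier G \<Longrightarrow> y [^] (6::nat) = \<one>"
  shows "G \<cong> integer_mod_group 6"
proof -
  let ?H = "range (\<lambda>k::nat. a [^] k)"
  have square: "b \<in> ?H" if b: "b \<in> carrier G" "b [^] (2::nat) = \<one>" for b
  proof (rule ccontr)
    assume H: "b \<notin> ?H"
    have "b [^] (4::nat) = \<one>"
      using b nat_pow_pow[of b 2 2] by simp
    \<comment> \<open>The exponent 4 is even, so it removes \<open>b\<close>, and multiplication by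
      4 sends both 2 and 5 to 2 modulo 6.\<close>
    then have "\<forall>j \<in> set [2, 5]. \<exists>k::nat. j * k mod ord a = 2 \<and> b [^] k = \<one>"
      using a(2) by (auto intro: exI[of _ 4])
    moreover have "\<forall>i \<in> set [2, 4, 5]. \<exists>k::nat. i * k mod ord a = 2"
      using a(2) by (auto intro: exI[of _ 4] exI[of _ 2])
    ultimately show False
      using planar_no_coset_clique[OF planar a(1) b(1), of "[2, 5]" "[2, 4, 5]" 2] a(2) H by auto
  qed
  have cube: "b \<in> ?H" if b: "b \<in> carrier G" "b [^] (3::nat) = \<one>" for b
  proof (rule ccontr)
    assume H: "b \<notin> ?H"
    have "\<forall>j \<in> set [3, 5]. \<exists>k::nat. j * k mod ord a = 3 \<and> b [^] k = \<one>"
      using a(2) b(2) by (auto intro: exI[of _ 3])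
    moreover have "\<forall>i \<in> set [1, 3, 5]. \<exists>k::nat. i * k mod ord a = 3"
      using a(2) by (auto intro: exI[of _ 3])
    ultimately show False
      using planar_no_coset_clique[OF planar a(1) b(1), of "[3, 5]" "[1, 3, 5]" 3] a(2) H by auto
  qed
  have "y \<in> ?H" if y: "y \<in> carrier G" for y
  proof -
    have "y [^] (2::nat) \<in> ?H" "y [^] (3::nat) \<in> ?H"
      using pow6[OF y] y by (simp_all add: square cube nat_pow_pow)
    then obtain k l :: nat where kl: "y [^] (2::nat) = a [^] k" "y [^] (3::nat) = a [^] l"
      by blast
    \<comment> \<open>The split 7 = 3 + 2 + 2 expresses \<open>y\<close> by its cube and its square
      without inverses.\<close>
    have "y = y [^] (6::nat) \<otimes> y"
      using pow6[OF y] y by simp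
    also have "\<dots> = y [^] (7::nat)"
      using nat_pow_Suc[of y 6] by simp
    also have "\<dots> = y [^] (3::nat) \<otimes> (y [^] (2::nat) \<otimes> y [^] (2::nat))"
      using y by (simp add: nat_pow_mult)
    finally show ?thesis
      using a by (simp add: kl nat_pow_mult)
  qed
  then show ?thesis
    using cyclic_imp_iso_integer_mod_group[OF fin a(1)] a(2) by simp
qed

text \<open>Coprime orders with product above 6 cannot both occur. So order 5 leaves only 1 and 5,
  order 4 forces exponent 4, and order 6 without 4 and 5 forces exponent 6. Of the orders up to 3, 2
  and 3 exclude each other, as a product would have order divisible by 6.\<close>

lemma (in comm_group) planar_imp_cases:
  assumes planar: "planar (generalized_power_graph G)" and fin: "finite (carrier G)"
  shows "elementary_abelian_group 2 G \<or> elementary_abelian_group 3 G \<or> elementary_abelian_group 5 G \<or>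
     G \<cong> integer_mod_group 4 \<or> G \<cong> integer_mod_group 6"
proof -
  have ord: "ord y \<in> {1, 2, 3, 4, 5, 6}" if "y \<in> carrier G" for y
    using planar_ord_le_6[OF planar fin that] ord_ge_1[OF fin that] by auto
  have product: "ord x * ord y \<le> 6" if xy: "x \<in> carrier G" "y \<in> carrier G" "coprime (ord x) (ord y)" for x y
  proof -
    have "x \<otimes> y \<in> carrier G"
      using xy by simp
    then have "ord (x \<otimes> y) \<le> 6" "ord (x \<otimes> y) > 0"
      using planar_ord_le_6[OF planar fin] ord_ge_1[OF fin] by force+
    then show ?thesis
      using dvd_imp_le[OF ord_mult_dvd_ord_mult[OF xy]] by linarith
  qed
  have coprimes: "coprime 5 (2::nat)" "coprime 5 (3::nat)" "coprime 5 (4::nat)" "coprime 5 (6::nat)"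
      "coprime 4 (3::nat)" "coprime 2 (3::nat)"
    by (simp_all add: coprime_iff_gcd_eq_1 gcd_non_0_nat)
  have elementary: "elementary_abelian_group p G"
    if "Factorial_Ring.prime p" "\<And>y. y \<in> carrier G \<Longrightarrow> ord y = 1 \<or> ord y = p" for p
    using that comm_group_axioms ord_eq_1 by (auto simp: elementary_abelian_group_def)
  have ord6: "ord (y [^] (2::nat)) = 3" if "y \<in> carrier G" "ord y = 6" for y
    using ord_pow[OF that(1), of 2] that by simp
  consider (5) "\<exists>a \<in> carrier G. ord a = 5" | (4) "\<exists>a \<in> carrier G. ord a = 4"
    | (6) "\<exists>a \<in> carrier G. ord a = 6" "\<forall>y \<in> carrier G. ord y \<noteq> 4 \<and> ord y \<noteq> 5"
    | (small) "\<forall>y \<in> carrier G. ord y \<noteq> 4 \<and> ord y \<noteq> 5 \<and> ord y \<noteq> 6"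
    by blast
  then show ?thesis
  proof cases
    case 5
    then obtain a where a: "a \<in> carrier G" "ord a = 5"
      by blast
    have "ord y = 1 \<or> ord y = 5" if "y \<in> carrier G" for y
      using ord[OF that] product[OF a(1) that] a(2) coprimes by auto
    then show ?thesis
      using elementary[of 5] by auto
  next
    case 4
    then obtain a where a: "a \<in> carrier G" "ord a = 4"
      by blast
    have "y [^] (4::nat) = \<one>" if y: "y \<in> carrier G" for y
    proof -
      have "ord y \<noteq> 3" "ord y \<noteq> 5"
        using product[OF a(1) y] product[OF y a(1)] a(2) coprimes by auto
      \<comment> \<open>Order 6 is not coprime to 4, but the square of such an element has order 3,
        which is.\<close>
      moreover have "ord y \<noteq> 6"
        using product[OF a(1) nat_pow_closed[OF y, of 2]] ord6[OF y] a(2) coprimes by auto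
      ultimately show ?thesis
        using ord[OF y] y by (auto simp: pow_eq_id)
    qed
    then show ?thesis
      using planar_ord_4_iso[OF planar fin a] by blast
  next
    case 6
    then obtain a where a: "a \<in> carrier G" "ord a = 6"
      by blast
    have "y [^] (6::nat) = \<one>" if y: "y \<in> carrier G" for y
      using ord[OF y] 6(2) y by (auto simp: pow_eq_id)
    then show ?thesis
      using planar_ord_6_iso[OF planar fin a] by blast
  next
    case small
    have ord_small: "ord y \<in> {1, 2, 3}" if "y \<in> carrier G" for y
      using ord[OF that] small that by auto
    show ?thesis
    proof (cases "\<exists>x \<in> carrier G. ord x = 2")
      case True
      then obtain x where x: "x \<in> carrier G" "ord x = 2"
        by blast
      have "ord y = 1 \<or> ord y = 2" if y: "y \<in> carrier G" for y
      proof -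
        have "\<not> 6 dvd ord (x \<otimes> y)"
          using ord_small[OF m_closed[OF x(1) y]] by auto
        then have "ord y \<noteq> 3"
          using ord_mult_dvd_ord_mult[OF x(1) y] x(2) coprimes by auto
        then show ?thesis
          using ord_small[OF y] by auto
      qed
      then show ?thesis
        using elementary[of 2] by auto
    next
      case False
      then show ?thesis
        using ord_small elementary[of 3] by auto
    qed
  qed
qed

subsection \<open>The planar cases\<close>

text \<open>The identity lies in both subgroups, so an intersection other than the trivial one
  contains a further element \<open>w\<close>.\<close>

lemma generalized_power_graph_edge:
  assumes "group G" "e \<in> snd (generalized_power_graph G)"
  obtains a b w where "a \<in> carrier G - {\<one>\<^bsub>G\<^esub>}" "b \<in> carrier G - {\<one>\<^bsub>G\<^esub>}" "e = {a, b}" "a \<noteq> b"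
    "w \<in> generate G {a}" "w \<in> generate G {b}" "w \<noteq> \<one>\<^bsub>G\<^esub>"
proof -
  obtain a b where ab: "a \<in> carrier G - {\<one>\<^bsub>G\<^esub>}" "b \<in> carrier G - {\<one>\<^bsub>G\<^esub>}" "e = {a, b}" "a \<noteq> b"
    "generate G {a} \<inter> generate G {b} \<noteq> {\<one>\<^bsub>G\<^esub>}"
    using assms(2) by (auto simp: generalized_power_graph_def)
  moreover have "\<one>\<^bsub>G\<^esub> \<in> generate G {a} \<inter> generate G {b}"
    by (auto intro: generate.one)
  ultimately show thesis
    using that by blast
qed

text \<open>Every nontrivial element of a group of prime order generates it, so adjacent vertices
  generate the same subgroup, and a class has at most \<open>p - 1\<close> members, hence at most
  four.\<close>

lemma elementary_abelian_imp_planar: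
  fixes G (structure)
  assumes "elementary_abelian_group p G" "p \<le> 5" "finite (carrier G)"
  shows "planar (generalized_power_graph G)"
proof -
  interpret comm_group G
    using assms(1) by (simp add: elementary_abelian_group_def)
  have ord: "ord x = p" if "x \<in> carrier G - {\<one>}" for x
    using assms(1) that by (auto simp: elementary_abelian_group_def)
  have gen: "generate G {x} \<subseteq> carrier G" if "x \<in> carrier G" for x
    using generate_in_carrier[of "{x}"] that by blast
  have card: "card (generate G {x}) = p" if "x \<in> carrier G - {\<one>}" for x
    using generate_pow_card[of x] ord[OF that] that by simp
  have eq: "generate G {w} = generate G {x}"
    if x: "x \<in> carrier G - {\<one>}" and w: "w \<in> generate G {x}" "w \<noteq> \<one>" for x w
  proof (rule card_subset_eq)
    show "finite (generate G {x})"
      using gen[of x] x assms(3) finite_subset by auto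
    show "generate G {w} \<subseteq> generate G {x}"
      using generate_subgroup_incl[of "{w}" "generate G {x}"] generate_is_subgroup[of "{x}"] x w by auto
    show "card (generate G {w}) = card (generate G {x})"
      using card[OF x] card[of w] gen[of x] x w by auto
  qed
  show ?thesis
  proof (rule planar_small_classes[of _ "\<lambda>x. generate G {x}"])
    show "finite (fst (generalized_power_graph G))"
      using assms(3) by (simp add: generalized_power_graph_def)
  next
    fix e assume "e \<in> snd (generalized_power_graph G)"
    then obtain a b w where ab: "a \<in> carrier G - {\<one>}" "b \<in> carrier G - {\<one>}" "e = {a, b}" "a \<noteq> b"
        and w: "w \<in> generate G {a}" "w \<in> generate G {b}" "w \<noteq> \<one>"
      by (rule generalized_power_graph_edge[OF is_group])
    have "generate G {a} = generate G {b}"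
      using eq[OF ab(1) w(1,3)] eq[OF ab(2) w(2,3)] by simp
    then show "\<exists>a b. a \<in> fst (generalized_power_graph G) \<and> b \<in> fst (generalized_power_graph G) \<and>
        e = {a, b} \<and> a \<noteq> b \<and> generate G {a} = generate G {b}"
      using ab by (intro exI[of _ a] exI[of _ b]) (simp add: generalized_power_graph_def)
  next
    fix a assume "a \<in> fst (generalized_power_graph G)"
    then have a: "a \<in> carrier G - {\<one>}"
      by (simp add: generalized_power_graph_def)
    have fin: "finite (generate G {a})"
      using gen[of a] a assms(3) finite_subset by auto
    have "b \<in> generate G {a} - {\<one>}" if "b \<in> carrier G - {\<one>}" "generate G {b} = generate G {a}" for b
      using that generate.incl[of b "{b}" G] by auto
    then have "card {b \<in> fst (generalized_power_graph G). generate G {b} = generate G {a}} \<le>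
        card (generate G {a} - {\<one>})"
      using fin by (intro card_mono) (auto simp: generalized_power_graph_def)
    also have "\<dots> = p - 1"
      using fin card[OF a] generate.one[of G "{a}"] by simp
    finally show "card {b \<in> fst (generalized_power_graph G). generate G {b} = generate G {a}} \<le> 4"
      using assms(2) by simp
  qed
qed

text \<open>There are fewer than five vertices, so all of them may form one class.\<close>

lemma iso_Z4_imp_planar:
  fixes G (structure)
  assumes "group G" "G \<cong> integer_mod_group 4"
  shows "planar (generalized_power_graph G)"
proof -
  interpret group G by (rule assms(1))
  obtain h where "bij_betw h (carrier G) (carrier (integer_mod_group 4))"
    using assms(2) by (auto simp: is_iso_def iso_def)
  then have card: "card (carrier G) = 4"
    using bij_betw_same_card by (fastforce simp: carrier_integer_mod_group)
  then have fin: "finite (carrier G)"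
    using card.infinite by fastforce
  show ?thesis
  proof (rule planar_small_classes[of _ "\<lambda>_. ()"])
    show "finite (fst (generalized_power_graph G))"
      using fin by (simp add: generalized_power_graph_def)
  next
    fix e assume "e \<in> snd (generalized_power_graph G)"
    then show "\<exists>a b. a \<in> fst (generalized_power_graph G) \<and> b \<in> fst (generalized_power_graph G) \<and>
        e = {a, b} \<and> a \<noteq> b \<and> () = ()"
      by (auto simp: generalized_power_graph_def)
  next
    fix a assume "a \<in> fst (generalized_power_graph G)"
    have "card {b \<in> fst (generalized_power_graph G). () = ()} \<le> card (carrier G)"
      using fin by (intro card_mono) (auto simp: generalized_power_graph_def)
    then show "card {b \<in> fst (generalized_power_graph G). () = ()} \<le> 4"
      using card by simp
  qed
qed

text \<open>The subgroups of orders 2 and 3 meet trivially, so the involution is not adjacent to the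
  two elements of order 3; these non-edges match the two pairs missing from
  \<open>cells\<close>.\<close>

lemma iso_Z6_imp_planar:
  fixes G (structure)
  assumes "group G" "G \<cong> integer_mod_group 6"
  shows "planar (generalized_power_graph G)"
proof -
  interpret group G by (rule assms(1))
  obtain h where h: "h \<in> hom G (integer_mod_group 6)" "bij_betw h (carrier G) (carrier (integer_mod_group 6))"
    using assms(2) by (auto simp: is_iso_def iso_def)
  have inj: "x = y" if "x \<in> carrier G" "y \<in> carrier G" "h x = h y" for x y
    using bij_betw_imp_inj_on[OF h(2)] that by (auto dest: inj_onD)
  have mult: "h (x \<otimes> y) = (h x + h y) mod 6" if "x \<in> carrier G" "y \<in> carrier G" for x y
    using hom_mult[OF h(1) that] by simp
  have "h \<one> = 0"
    using hom_one[OF h(1) is_group group_integer_mod_group] by simp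
  then have range: "h x \<in> {1, 2, 3, 4, 5}" if x: "x \<in> carrier G - {\<one>}" for x
  proof -
    have "h x \<noteq> 0"
      using inj[of x \<one>] x \<open>h \<one> = 0\<close> by auto
    moreover have "0 \<le> h x" "h x < 6"
      using bij_betw_apply[OF h(2), of x] x by (auto simp: carrier_integer_mod_group)
    ultimately have "h x = 1 \<or> h x = 2 \<or> h x = 3 \<or> h x = 4 \<or> h x = 5"
      by linarith
    then show ?thesis
      by simp
  qed
  have involution: "x [^] (2::nat) = \<one>" if "x \<in> carrier G" "h x = 3" for x
    using that mult[of x x] \<open>h \<one> = 0\<close> by (intro inj) (simp_all add: numeral_2_eq_2)
  have cube: "x [^] (3::nat) = \<one>" if "x \<in> carrier G" "h x = 2 \<or> h x = 4" for x
    using that mult[of x x] mult[of "x \<otimes> x" x] \<open>h \<one> = 0\<close>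
    by (intro inj) (auto simp: numeral_3_eq_3)
  have no_edge: "w = \<one>"
    if x: "x \<in> carrier G" "h x = 3" and y: "y \<in> carrier G" "h y = 2 \<or> h y = 4"
      and w: "w \<in> generate G {x}" "w \<in> generate G {y}" for x y w
  proof -
    have wG: "w \<in> carrier G"
      using generate_in_carrier[of "{x}"] x w by blast
    \<comment> \<open>An exponent that annihilates \<open>v\<close> annihilates its power
      \<open>w\<close>; as both 2 and 3 do so for \<open>w\<close>, it is trivial.\<close>
    have "w [^] (int n) = \<one>" if v: "v \<in> carrier G" "w \<in> generate G {v}" "v [^] n = \<one>" for v n
    proof -
      obtain i :: int where "w = v [^] i"
        using generate_pow[OF v(1)] v(2) by blast
      then have "w [^] (int n) = (v [^] int n) [^] i"
        using v(1) by (simp only: int_pow_pow mult.commute)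
      then show ?thesis
        using v(3) by (simp add: int_pow_int int_pow_one)
    qed
    from this[OF x(1) w(1) involution[OF x]] this[OF y(1) w(2) cube[OF y]]
    have "w [^] (2::int) = \<one>" "w [^] (3::int) = \<one>"
      by simp_all
    then show "w = \<one>"
      using int_pow_mult[OF wG, of 2 1] wG by simp
  qed
  \<comment> \<open>The generators, residues 1 and 5, take the labels 0 and 1 joined to all others;
    residues 2 and 4 take 2 and 3, and the involution, residue 3, takes 4.\<close>
  define r :: "'a \<Rightarrow> nat" where
    "r x = (if h x = 1 then 0 else if h x = 5 then 1 else if h x = 2 then 2 else if h x = 4 then 3 else 4)" for x
  show ?thesis
  proof (rule planar_disjoint_union_K5_minus_two_edges[of _ "\<lambda>_. 0" r])
    fix e assume "e \<in> snd (generalized_power_graph G)"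
    then obtain a b w where ab: "a \<in> carrier G - {\<one>}" "b \<in> carrier G - {\<one>}" "e = {a, b}" "a \<noteq> b"
        and w: "w \<in> generate G {a}" "w \<in> generate G {b}" "w \<noteq> \<one>"
      by (rule generalized_power_graph_edge[OF is_group])
    have "h a \<noteq> h b"
      using inj[of a b] ab by auto
    moreover have "\<not> (h a = 3 \<and> (h b = 2 \<or> h b = 4))" "\<not> (h b = 3 \<and> (h a = 2 \<or> h a = 4))"
      using no_edge[of a b w] no_edge[of b a w] ab w by blast+
    ultimately have "(r a, r b) \<in> cells \<or> (r b, r a) \<in> cells"
      using range[OF ab(1)] range[OF ab(2)] by (auto simp: r_def cells_def)
    moreover have "e = {b, a}"
      using ab by auto
    ultimately show "\<exists>a b. a \<in> fst (generalized_power_graph G) \<and> b \<in> fst (generalized_power_graph G) \<and>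
        e = {a, b} \<and> a \<noteq> b \<and> (0::nat) = 0 \<and> (r a, r b) \<in> cells"
      using ab unfolding generalized_power_graph_def fst_conv by metis
  next
    show "r a < 5" for a
      by (simp add: r_def)
    show "a = b" if "a \<in> fst (generalized_power_graph G)" "b \<in> fst (generalized_power_graph G)"
        "(0::nat) = 0" "r a = r b" for a b
    proof (rule inj)
      have ab: "a \<in> carrier G - {\<one>}" "b \<in> carrier G - {\<one>}"
        using that by (auto simp: generalized_power_graph_def)
      then show "a \<in> carrier G" "b \<in> carrier G"
        by auto
      show "h a = h b"
        using range[OF ab(1)] range[OF ab(2)] that(4) by (auto simp: r_def split: if_splits)
    qed
  qed
qed

theorem theorem4p4:
  fixes G :: "('a, 'b) monoid_scheme"
  assumes "comm_group G" and "finite (carrier G)"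
  shows "planar (generalized_power_graph G) \<longleftrightarrow>
     elementary_abelian_group 2 G \<or>
     elementary_abelian_group 3 G \<or>
     elementary_abelian_group 5 G \<or>
     G \<cong> integer_mod_group 4 \<or>
     G \<cong> integer_mod_group 6"
proof -
  interpret comm_group G by (rule assms(1))
  show ?thesis
    using planar_imp_cases[OF _ assms(2)] elementary_abelian_imp_planar[OF _ _ assms(2)]
      iso_Z4_imp_planar[OF is_group] iso_Z6_imp_planar[OF is_group]
    \<comment> \<open>The numeral rules establish the bound \<open>p \<le> 5\<close> for 2, 3 and
      5.\<close>
    by (metis numeral_le_iff semiring_norm(68,69,71,72,73))
qed

end
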